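(* Let $(\nu_t)_{t\in\mathbb{R}}$ be an evolution system of measures for $P_{s,t}$ such that $$\exists\,\alpha>0:\quad\sup_{t\in\mathbb{R}}\int_{\mathbb{R}^n}|x|^\alpha\,\nu_t(dx)<+\infty.$$ Then $\nu_t=\mathcal{N}_{g(t,-\infty),Q(t,-\infty)}$ for each $t\in\mathbb{R}$.
   Context: Standing assumptions. $A,B:\mathbb{R}\to\mathcal{L}(\mathbb{R}^n)$ and $f:\mathbb{R}\to\mathbb{R}^n$ are continuous and bounded. There is $\mu_0>0$ with $\|B(t)x\|\ge\mu_0\|x\|$ for all $t\in\mathbb{R}$, $x\in\mathbb{R}^n$. $U(t,s)$ ($t,s\in\mathbb{R}$) is the evolution family generated by $A(\cdot)$, i.e. $\partial_tU(t,s)=A(t)U(t,s)$, $U(s,s)=I$, and its growth bound $\omega_0(U):=\inf\{\omega\in\mathbb{R}:\exists M=M(\omega)\text{ such that }\|U(t,s)\|\le Me^{\omega(t-s)},\ -\infty<s\le t<\infty\}$ satisfies $\omega_0(U)<0$. Notation. For $-\infty\le s<t$ put $g(t,s)=\int_s^tU(t,r)f(r)\,dr$ and $Q(t,s)=\int_s^tU(t,r)B(r)B^*(r)U^*(t,r)\,dr$. $\mathcal{N}_{m,Q}$ is the Gaussian measure on $\mathbb{R}^n$ with mean $m$ and covariance $Q$. For $-\infty<s\le t<\infty$, $P_{s,t}\varphi(x)=\int_{\mathbb{R}^n}\varphi(y+g(t,s))\,\mathcal{N}_{U(t,s)x,Q(t,s)}(dy)$, $\varphi\in C_b(\mathbb{R}^n)$.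 An evolution system of measures for $P_{s,t}$ is a family of Borel probability measures $(\nu_t)_{t\in\mathbb{R}}$ in $\mathbb{R}^n$ such that $\int_{\mathbb{R}^n}P_{s,t}\varphi(x)\,\nu_s(dx)=\int_{\mathbb{R}^n}\varphi(x)\,\nu_t(dx)$ for all $\varphi\in C_b(\mathbb{R}^n)$ and $s\le t$. *)

theory Defs
  imports "HOL-Probability.Probability" "HOL-Analysis.Bounded_Continuous_Function"
begin

text \<open>Linear operators on $\mathbb{R}^n$ are represented by their matrices; the adjoint is the
  transpose and the operator norm is \<open>onorm\<close> of the matrix action (the norm of the type of matrices
  is the equivalent Frobenius norm).\<close>

definition evolution_family ::
  "(real \<Rightarrow> real^'n^'n) \<Rightarrow> (real \<Rightarrow> real \<Rightarrow> real^'n^'n) \<Rightarrow> bool" where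
  "evolution_family A U \<longleftrightarrow>
     (\<forall>s. U s s = mat 1) \<and>
     (\<forall>t s. ((\<lambda>\<tau>. U \<tau> s) has_vector_derivative (A t ** U t s)) (at t))"

text \<open>The infimum is taken in the extended reals, so that it is meaningful without knowing that the
  set of admissible exponents is nonempty and bounded below.\<close>

definition growth_bound :: "(real \<Rightarrow> real \<Rightarrow> real^'n^'n) \<Rightarrow> ereal" where
  "growth_bound U = Inf (ereal ` {\<omega>. \<exists>M. \<forall>s t. s \<le> t \<longrightarrow>
     onorm ((*v) (U t s)) \<le> M * exp (\<omega> * (t - s))})"

text \<open>The lower limit \<open>s\<close> is an extended real, so \<open>s = -\<infinity>\<close> is allowed.\<close>

definition drift ::
  "(real \<Rightarrow> real \<Rightarrow> real^'n^'n) \<Rightarrow> (real \<Rightarrow> real^'n) \<Rightarrow> real \<Rightarrow> ereal \<Rightarrow> real^'n" where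
  "drift U f t s = (LBINT r=s..ereal t. U t r *v f r)"

definition covar ::
  "(real \<Rightarrow> real \<Rightarrow> real^'n^'n) \<Rightarrow> (real \<Rightarrow> real^'n^'n) \<Rightarrow> real \<Rightarrow> ereal \<Rightarrow> real^'n^'n" where
  "covar U B t s =
     (LBINT r=s..ereal t. U t r ** B r ** transpose (B r) ** transpose (U t r))"

text \<open>One-dimensional Gaussian law with mean \<open>m\<close> and standard deviation \<open>\<sigma>\<close>, including the Dirac
  measure for \<open>\<sigma> = 0\<close>.\<close>

definition gaussian1 :: "real \<Rightarrow> real \<Rightarrow> real measure" where
  "gaussian1 m \<sigma> = (if \<sigma> = 0 then return borel m
     else density lborel (\<lambda>x. ennreal (normal_density m \<sigma> x)))"

definition gaussian_measure :: "(real^'n) measure \<Rightarrow> bool" where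
  "gaussian_measure M \<longleftrightarrow> prob_space M \<and> sets M = sets borel \<and>
     (\<forall>h. \<exists>m \<sigma>. \<sigma> \<ge> 0 \<and> distr M borel (\<lambda>x. x \<bullet> h) = gaussian1 m \<sigma>)"

text \<open>The Gaussian measure on $\mathbb{R}^n$ with mean \<open>m\<close> and covariance matrix \<open>Q\<close>. It exists and is
  unique whenever \<open>Q\<close> is symmetric and positive semidefinite (for \<open>Q = 0\<close> it is the Dirac
  measure at \<open>m\<close>); for other \<open>Q\<close> the value is unspecified.\<close>

definition gaussian :: "real^'n \<Rightarrow> real^'n^'n \<Rightarrow> (real^'n) measure" where
  "gaussian m Q = (THE M. gaussian_measure M \<and>
     (\<integral>x. x \<partial>M) = m \<and>
     (\<forall>h k. (\<integral>x. ((x - m) \<bullet> h) * ((x - m) \<bullet> k) \<partial>M) = (Q *v h) \<bullet> k))"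

definition OU_operator ::
  "(real \<Rightarrow> real \<Rightarrow> real^'n^'n) \<Rightarrow> (real \<Rightarrow> real^'n^'n) \<Rightarrow> (real \<Rightarrow> real^'n) \<Rightarrow>
     real \<Rightarrow> real \<Rightarrow> (real^'n \<Rightarrow> real) \<Rightarrow> real^'n \<Rightarrow> real" where
  "OU_operator U B f s t \<phi> x =
     (\<integral>y. \<phi> (y + drift U f t (ereal s)) \<partial>gaussian (U t s *v x) (covar U B t (ereal s)))"

definition evolution_system_of_measures ::
  "(real \<Rightarrow> real \<Rightarrow> (real^'n \<Rightarrow> real) \<Rightarrow> real^'n \<Rightarrow> real) \<Rightarrow> (real \<Rightarrow> (real^'n) measure) \<Rightarrow> bool" where
  "evolution_system_of_measures P \<nu> \<longleftrightarrow>
     (\<forall>t. prob_space (\<nu> t) \<and> sets (\<nu> t) = sets borel) \<and>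
     (\<forall>s t. s \<le> t \<longrightarrow> (\<forall>\<phi>\<in>bcontfun. (\<integral>x. P s t \<phi> x \<partial>\<nu> s) = (\<integral>x. \<phi> x \<partial>\<nu> t)))"

end

theory Submission
  imports Defs
begin

text \<open>Testing the evolution system with \<open>cos (x \<bullet> h)\<close> and \<open>sin (x \<bullet> h)\<close> gives, for the characteristic
  functions \<open>\<chi>\<^sub>t\<close> of \<open>\<nu> t\<close> and \<open>s \<le> t\<close>, the identity
  \<open>\<chi>\<^sub>t h = exp (i g(t,s) \<bullet> h - Q(t,s) h \<bullet> h / 2) * \<chi>\<^sub>s (U(t,s)\<^sup>T h)\<close>. As \<open>s\<close> tends to \<open>-\<infinity>\<close> the argument
  \<open>U(t,s)\<^sup>T h\<close> decays exponentially, and the uniform moment bound makes the \<open>\<chi>\<^sub>s\<close> equicontinuous at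
  \<open>0\<close>, so the last factor tends to \<open>1\<close>. Hence \<open>\<chi>\<^sub>t\<close> is the characteristic function of the claimed
  Gaussian measure, and characteristic functions determine measures.\<close>

subsection \<open>Gaussian characteristic functions\<close>

text \<open>\<open>gaussian\<close> is a definite description through marginals and moments, so even
  evaluating \<open>OU_operator\<close> on a single test function requires that such a measure
  exists and is unique for the given symmetric positive semidefinite matrix. Densities cannot serve
  throughout, because the covariance vanishes at s = t. Existence therefore comes from adding
  independent one-dimensional Gaussians to a Dirac measure. Uniqueness comes from smoothing with a
  Gaussian, whose density is itself a characteristic function up to a constant factor. In the final
  limit the measure \<open>\<nu> s\<close> changes together with its argument, so continuity of each
  single characteristic function at 0 would not be enough; the bound has to be uniform in s. Since
  the moment exponent \<alpha> may lie below 1, this bound is of Hoelder and not of Lipschitz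
  type.\<close>

lemma gaussian1_eq_distr:
  assumes "\<sigma> \<ge> 0"
  shows "gaussian1 m \<sigma> = distr std_normal_distribution borel (\<lambda>x. m + \<sigma> * x)"
proof -
  interpret S: prob_space std_normal_distribution by (simp add: prob_space_normal_density)
  show ?thesis
  proof (cases "\<sigma> = 0")
    case True
    then show ?thesis by (simp add: gaussian1_def S.distr_const)
  next
    case False
    with assms have "\<sigma> > 0" by simp
    have "distributed std_normal_distribution lborel (\<lambda>x. x) std_normal_density"
      by (auto simp: distributed_def distr_id2)
    from S.normal_density_affine[OF this, of \<sigma> m] \<open>\<sigma> > 0\<close>
    have "distr std_normal_distribution lborel (\<lambda>x. m + \<sigma> * x) = density lborel (normal_density m \<sigma>)"
      by (auto simp: distributed_def)
    moreover have "distr std_normal_distribution lborel (\<lambda>x. m + \<sigma> * x) =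
        distr std_normal_distribution borel (\<lambda>x. m + \<sigma> * x)"
      by (rule distr_cong) auto
    ultimately show ?thesis using False by (simp add: gaussian1_def)
  qed
qed

text \<open>The affine image of a standard normal variable treats the Dirac case and the density
  case at once, so neither this computation nor that of the moments splits on \<sigma> = 0.\<close>

lemma char_gaussian1:
  assumes "\<sigma> \<ge> 0"
  shows "char (gaussian1 m \<sigma>) t = iexp (t * m) * exp (- complex_of_real ((t * \<sigma>)\<^sup>2 / 2))"
proof -
  have "char (gaussian1 m \<sigma>) t = (CLINT x|std_normal_distribution. iexp (t * (m + \<sigma> * x)))"
    by (simp add: gaussian1_eq_distr[OF assms] char_def integral_distr del: of_real_mult of_real_add)
  also have "\<dots> = (CLINT x|std_normal_distribution. iexp (t * m) * iexp ((t * \<sigma>) * x))"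
    by (intro Bochner_Integration.integral_cong) (auto simp: algebra_simps exp_add)
  also have "\<dots> = iexp (t * m) * char std_normal_distribution (t * \<sigma>)"
    by (simp add: char_def)
  also have "\<dots> = iexp (t * m) * exp (- complex_of_real ((t * \<sigma>)\<^sup>2 / 2))"
    by (simp add: char_std_normal_distribution exp_of_real[symmetric])
  finally show ?thesis .
qed

lemma real_distribution_gaussian1:
  assumes "\<sigma> \<ge> 0"
  shows "real_distribution (gaussian1 m \<sigma>)"
proof -
  interpret S: prob_space std_normal_distribution by (simp add: prob_space_normal_density)
  have "prob_space (distr std_normal_distribution borel (\<lambda>x. m + \<sigma> * x))"
    by (rule S.prob_space_distr) simp
  then show ?thesis
    unfolding gaussian1_eq_distr[OF assms] by (simp add: real_distribution_def real_distribution_axioms_def)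
qed

lemma gaussian1_moments:
  assumes "\<sigma> \<ge> 0"
  shows "has_bochner_integral (gaussian1 m \<sigma>) (\<lambda>x. x) m"
    and "has_bochner_integral (gaussian1 m \<sigma>) (\<lambda>x. (x - m)\<^sup>2) (\<sigma>\<^sup>2)"
proof -
  interpret S: prob_space std_normal_distribution by (simp add: prob_space_normal_density)
  have 1: "has_bochner_integral std_normal_distribution (\<lambda>x. x) 0"
    using std_normal_moment_odd[of 0] by (simp add: has_bochner_integral_density)
  have 2: "has_bochner_integral std_normal_distribution (\<lambda>x. x\<^sup>2) 1"
    using std_normal_moment_even[of 1] by (simp add: has_bochner_integral_density fact_2)
  have 3: "has_bochner_integral std_normal_distribution (\<lambda>x. m) m"
    using has_bochner_integral_integrable[OF S.integrable_const[of m]] S.prob_space by simp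
  have "has_bochner_integral std_normal_distribution (\<lambda>x. m + \<sigma> * x) (m + \<sigma> * 0)"
    by (intro has_bochner_integral_add has_bochner_integral_mult_right 1 3)
  then show "has_bochner_integral (gaussian1 m \<sigma>) (\<lambda>x. x) m"
    unfolding gaussian1_eq_distr[OF assms] by (intro has_bochner_integral_distr) auto
  have "has_bochner_integral std_normal_distribution (\<lambda>x. \<sigma>\<^sup>2 * x\<^sup>2) (\<sigma>\<^sup>2 * 1)"
    by (intro has_bochner_integral_mult_right 2)
  then show "has_bochner_integral (gaussian1 m \<sigma>) (\<lambda>x. (x - m)\<^sup>2) (\<sigma>\<^sup>2)"
    unfolding gaussian1_eq_distr[OF assms]
    by (intro has_bochner_integral_distr) (auto simp: power_mult_distrib)
qed

section \<open>Characteristic functions on Euclidean spaces\<close>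

definition mchar :: "'a::euclidean_space measure \<Rightarrow> 'a \<Rightarrow> complex" where
  "mchar M h = (CLINT x|M. iexp (x \<bullet> h))"

text \<open>Cramer-Wold bridge: through it the one-dimensional Levy uniqueness theorem and
  \<open>char_gaussian1\<close> apply to the marginals of M.\<close>

lemma char_distr_inner:
  assumes "sets M = sets borel"
  shows "char (distr M borel (\<lambda>x. x \<bullet> h)) t = mchar M (t *\<^sub>R h)"
proof -
  have [measurable_cong]: "sets M = sets borel" by fact
  show ?thesis by (simp add: char_def mchar_def integral_distr del: of_real_mult)
qed

lemma integrable_iexp_inner:
  assumes "prob_space M" "sets M = sets borel"
  shows "integrable M (\<lambda>x::'a::euclidean_space. iexp (x \<bullet> h))"
proof -
  interpret prob_space M by fact
  have [measurable_cong]: "sets M = sets borel" by fact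
  show ?thesis by (rule integrable_iexp) auto
qed

text \<open>Inductive step of the existence proof: an independent summand \<xi> v with \<xi>
  standard normal adds the rank-one form with value (v \<bullet> h)^2 to the covariance. Fubini
  separates the two factors.\<close>

lemma mchar_distr_add_scaled_normal:
  fixes M :: "'a::euclidean_space measure" and v :: 'a
  assumes "prob_space M" and S: "sets M = sets borel"
  defines "N \<equiv> distr (M \<Otimes>\<^sub>M std_normal_distribution) borel (\<lambda>(x, \<xi>). x + \<xi> *\<^sub>R v)"
  shows "prob_space N" "mchar N h = mchar M h * exp (- complex_of_real ((v \<bullet> h)\<^sup>2 / 2))"
proof -
  interpret prob_space M by fact
  interpret S: prob_space std_normal_distribution by (simp add: prob_space_normal_density)
  interpret P: pair_prob_space M std_normal_distribution ..
  have [measurable_cong]: "sets M = sets borel" by fact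
  show "prob_space N" unfolding N_def by (rule P.prob_space_distr) measurable
  have int: "integrable (M \<Otimes>\<^sub>M std_normal_distribution) (\<lambda>z. iexp ((fst z + snd z *\<^sub>R v) \<bullet> h))"
    by (rule P.integrable_iexp) auto
  have "mchar N h = (CLINT z|M \<Otimes>\<^sub>M std_normal_distribution. iexp ((fst z + snd z *\<^sub>R v) \<bullet> h))"
    unfolding mchar_def N_def by (subst integral_distr) (auto simp: case_prod_beta)
  also have "\<dots> = (CLINT x|M. CLINT \<xi>|std_normal_distribution. iexp ((x + \<xi> *\<^sub>R v) \<bullet> h))"
    by (rule P.integral_fst[symmetric, of "\<lambda>x \<xi>. iexp ((x + \<xi> *\<^sub>R v) \<bullet> h)",
      unfolded case_prod_unfold, OF int])
  also have "\<dots> = (CLINT x|M. CLINT \<xi>|std_normal_distribution. iexp (x \<bullet> h) * iexp ((v \<bullet> h) * \<xi>))"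
    by (intro Bochner_Integration.integral_cong) (auto simp: inner_add_left algebra_simps exp_add)
  also have "\<dots> = (CLINT x|M. iexp (x \<bullet> h) * char std_normal_distribution (v \<bullet> h))"
    by (simp add: char_def)
  also have "\<dots> = mchar M h * exp (- complex_of_real ((v \<bullet> h)\<^sup>2 / 2))"
    by (simp add: mchar_def char_std_normal_distribution exp_of_real[symmetric])
  finally show "mchar N h = mchar M h * exp (- complex_of_real ((v \<bullet> h)\<^sup>2 / 2))" .
qed

text \<open>Each rank-one part of the covariance is realised by an independent one-dimensional Gaussian;
  splitting it off lowers the rank, because the remainder annihilates \<open>h\<close>.\<close>

lemma ex_measure_mchar_gaussian:
  fixes Q :: "'a::euclidean_space \<Rightarrow> 'a"
  assumes "linear Q" "\<And>x y. Q x \<bullet> y = x \<bullet> Q y" "\<And>x. Q x \<bullet> x \<ge> 0"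
  shows "\<exists>M. prob_space M \<and> sets M = sets borel \<and>
    (\<forall>h. mchar M h = iexp (m \<bullet> h) * exp (- complex_of_real (Q h \<bullet> h / 2)))"
  using assms
proof (induction "dim (range Q)" arbitrary: Q rule: less_induct)
  case less
  interpret Q: linear Q by fact
  show ?case
  proof (cases "\<forall>h. Q h \<bullet> h = 0")
    case True
    \<comment> \<open>The mean enters only here, as the position of the Dirac measure; all Gaussians
      added later are centred.\<close>
    have "mchar (return borel m) h = iexp (m \<bullet> h)" for h
      unfolding mchar_def by (rule integral_return) auto
    with True show ?thesis
      by (intro exI[of _ "return borel m"]) (auto simp: prob_space_return)
  next
    case False
    then obtain h where h: "Q h \<bullet> h > 0" using less.prems(3) by (metis less_eq_real_def)
    define c where "c = Q h \<bullet> h"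
    \<comment> \<open>Normalised so that (v \<bullet> h) v = Q h; subtracting the rank-one part
      given by v then kills h.\<close>
    define v where "v = Q h /\<^sub>R sqrt c"
    define Q' where "Q' x = Q x - (v \<bullet> x) *\<^sub>R v" for x
    have c: "c > 0" using h by (simp add: c_def)
    have vv: "(v \<bullet> x) *\<^sub>R v = ((Q h \<bullet> x) / c) *\<^sub>R Q h" for x
      using c by (simp add: v_def field_simps)
    have lin: "linear Q'"
      unfolding Q'_def
      by (intro linearI) (auto simp: Q.add Q.scale algebra_simps inner_add_right)
    have sym: "Q' x \<bullet> y = x \<bullet> Q' y" for x y
      using less.prems(2)[of x y] by (simp add: Q'_def inner_diff_left inner_diff_right inner_commute)
    have Q'h: "Q' h = 0" using c by (simp add: Q'_def vv c_def)
    have pos: "Q' x \<bullet> x \<ge> 0" for x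
    proof -
      \<comment> \<open>This t minimises the quadratic form of Q along the line x - t h, and the
        minimum is exactly the form of \<open>Q'\<close> at x.\<close>
      define t where "t = (Q h \<bullet> x) / c"
      have "0 \<le> Q (x - t *\<^sub>R h) \<bullet> (x - t *\<^sub>R h)" by (rule less.prems)
      also have "\<dots> = Q x \<bullet> x - 2 * t * (Q h \<bullet> x) + t * t * c"
        using less.prems(2)[of x h]
        by (simp add: Q.diff Q.scale inner_diff_left inner_diff_right c_def algebra_simps inner_commute)
      also have "\<dots> = Q' x \<bullet> x"
        using c by (simp add: Q'_def vv inner_diff_left t_def field_simps)
      finally show ?thesis .
    qed
    have "range Q' \<subseteq> range Q"
    proof
      fix y assume "y \<in> range Q'"
      then obtain x where "y = Q' x" by auto
      then have "y = Q (x - ((Q h \<bullet> x) / c) *\<^sub>R h)" by (simp add: Q'_def vv Q.diff Q.scale)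
      then show "y \<in> range Q" by auto
    qed
    \<comment> \<open>If Q h were \<open>Q' x\<close>, symmetry would give Q h \<bullet> h =
      \<open>x \<bullet> Q' h\<close> = 0, contradicting the choice of h.\<close>
    moreover have "Q h \<notin> range Q'"
      using h sym[of _ h] Q'h by force
    ultimately have "range Q' \<subset> range Q" by auto
    moreover have "span (range Q') = range Q'" "span (range Q) = range Q"
      using lin less.prems(1) by (auto intro: linear_subspace_image simp: span_eq_iff)
    ultimately have "dim (range Q') < dim (range Q)" by (metis dim_psubset)
    from less.hyps[OF this lin sym pos] obtain M where M: "prob_space M" "sets M = sets borel"
      "\<And>h. mchar M h = iexp (m \<bullet> h) * exp (- complex_of_real (Q' h \<bullet> h / 2))" by auto
    have "Q x \<bullet> x = Q' x \<bullet> x + (v \<bullet> x)\<^sup>2" for x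
      by (simp add: Q'_def inner_diff_left power2_eq_square)
    then show ?thesis
      using mchar_distr_add_scaled_normal[OF M(1,2), of v]
      by (intro exI[of _ "distr (M \<Otimes>\<^sub>M std_normal_distribution) borel (\<lambda>(x, \<xi>). x + \<xi> *\<^sub>R v)"])
        (simp add: M(3) mult_exp_exp algebra_simps add_divide_distrib)
  qed
qed

subsection \<open>Uniqueness of characteristic functions\<close>

text \<open>The indicator of an open set is the pointwise limit of the continuous functions min 1 (k
  dist(x, complement)), and open sets form an intersection-stable generator. Nonnegative integrals
  avoid integrability conditions.\<close>

lemma measure_eqI_nn_integral_continuous:
  fixes M N :: "'a::metric_space measure"
  assumes "prob_space M" "sets M = sets borel" "prob_space N" "sets N = sets borel"
    and eq: "\<And>\<phi>::'a \<Rightarrow> real. continuous_on UNIV \<phi> \<Longrightarrow> (\<And>x. 0 \<le> \<phi> x) \<Longrightarrow> (\<And>x. \<phi> x \<le> 1) \<Longrightarrow>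
      (\<integral>\<^sup>+x. ennreal (\<phi> x) \<partial>M) = (\<integral>\<^sup>+x. ennreal (\<phi> x) \<partial>N)"
  shows "M = N"
proof -
  interpret M: prob_space M by fact
  interpret N: prob_space N by fact
  have [measurable_cong]: "sets M = sets borel" "sets N = sets borel" by fact+
  have "emeasure M S = emeasure N S" if "open S" for S
  \<comment> \<open>The whole space is separate because \<open>infdist\<close> to the empty set is
    0, which would make all approximating functions vanish.\<close>
  proof (cases "S = UNIV")
    case True
    then show ?thesis
      using M.emeasure_space_1 N.emeasure_space_1 sets_eq_imp_space_eq[OF assms(2)]
        sets_eq_imp_space_eq[OF assms(4)] by simp
  next
    case False
    define \<phi> where "\<phi> k x = min 1 (real k * infdist x (- S))" for k x
    have lim: "(\<lambda>k. ennreal (\<phi> k x)) \<longlonglongrightarrow> indicator S x" for x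
    proof (cases "x \<in> S")
      case True
      then have pos: "infdist x (- S) > 0"
        using infdist_pos_not_in_closed[of "- S" x] \<open>open S\<close> False by auto
      obtain n where n: "real n * infdist x (- S) > 1"
        using reals_Archimedean3[OF pos] by blast
      have "eventually (\<lambda>k. ennreal (\<phi> k x) = 1) sequentially"
        using eventually_ge_at_top[of n]
      proof eventually_elim
        case (elim k)
        then have "real n * infdist x (- S) \<le> real k * infdist x (- S)"
          using pos by (intro mult_right_mono) auto
        with n show ?case by (simp add: \<phi>_def)
      qed
      with True show ?thesis by (simp add: tendsto_eventually)
    next
      case False
      then show ?thesis by (simp add: \<phi>_def)
    qed
    have conv: "(\<lambda>k. \<integral>\<^sup>+x. \<phi> k x \<partial>L) \<longlonglongrightarrow> emeasure L S"
      if "prob_space L" "sets L = sets borel" for L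
    proof -
      interpret L: prob_space L by fact
      have [measurable_cong]: "sets L = sets borel" by fact
      have "(\<lambda>k. \<integral>\<^sup>+x. \<phi> k x \<partial>L) \<longlonglongrightarrow> (\<integral>\<^sup>+x. indicator S x \<partial>L)"
      proof (rule nn_integral_dominated_convergence[where w="\<lambda>_. 1"])
        show "(\<lambda>x. ennreal (\<phi> k x)) \<in> borel_measurable L" for k
        proof -
          have "\<phi> k \<in> borel_measurable borel"
            unfolding \<phi>_def by (intro borel_measurable_continuous_onI continuous_intros)
          then show ?thesis by measurable
        qed
        show "(\<lambda>x. indicator S x) \<in> borel_measurable L"
          by (intro borel_measurable_indicator) (simp add: that(2) \<open>open S\<close>)
        show "AE x in L. (\<lambda>k. ennreal (\<phi> k x)) \<longlonglongrightarrow> indicator S x" using lim by simp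
        show "AE x in L. ennreal (\<phi> k x) \<le> 1" for k by (simp add: \<phi>_def)
      qed (simp_all add: L.emeasure_space_1)
      also have "(\<integral>\<^sup>+x. indicator S x \<partial>L) = emeasure L S"
        using \<open>open S\<close> that(2) by simp
      finally show ?thesis .
    qed
    have "(\<integral>\<^sup>+x. \<phi> k x \<partial>M) = (\<integral>\<^sup>+x. \<phi> k x \<partial>N)" for k
      unfolding \<phi>_def by (rule eq) (auto intro!: continuous_intros simp: infdist_nonneg)
    with conv[OF assms(1,2)] conv[OF assms(3,4)] show ?thesis
      by (simp add: LIMSEQ_unique)
  qed
  then show ?thesis
    by (intro measure_eqI_generator_eq[where E="{S. open S}" and \<Omega>=UNIV and A="\<lambda>_. UNIV"])
      (auto simp: Int_stable_def assms sets_borel borel_def)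
qed

section \<open>Smoothing with a Gaussian kernel\<close>

text \<open>The standard Gaussian density, written as a product so that its total mass factors into
  one-dimensional integrals; the rotation-invariant form follows in
  \<open>gaussian_kernel_eq\<close>.\<close>

definition gaussian_kernel :: "'a::euclidean_space \<Rightarrow> real" where
  "gaussian_kernel z = (\<Prod>b\<in>Basis. std_normal_density (z \<bullet> b))"

lemma gaussian_kernel_nonneg: "gaussian_kernel z \<ge> 0"
  by (simp add: gaussian_kernel_def prod_nonneg)

lemma borel_measurable_gaussian_kernel [measurable]: "gaussian_kernel \<in> borel_measurable borel"
  unfolding gaussian_kernel_def by measurable

lemma gaussian_kernel_eq: "gaussian_kernel (z::'a::euclidean_space) = (1 / sqrt (2 * pi)) ^ DIM('a) * exp (- (z \<bullet> z) / 2)"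
proof -
  have "gaussian_kernel z = (\<Prod>b\<in>(Basis::'a set). 1 / sqrt (2 * pi)) * (\<Prod>b\<in>(Basis::'a set). exp (- (z \<bullet> b)\<^sup>2 / 2))"
    by (simp only: gaussian_kernel_def std_normal_density_def prod.distrib)
  also have "(\<Prod>b\<in>(Basis::'a set). exp (- (z \<bullet> b)\<^sup>2 / 2)) = exp (\<Sum>b\<in>Basis. - (z \<bullet> b)\<^sup>2 / 2)"
    by (simp add: exp_sum)
  also have "(\<Sum>b\<in>(Basis::'a set). - (z \<bullet> b)\<^sup>2 / 2) = - (z \<bullet> z) / 2"
    by (simp add: euclidean_inner[of z z] sum_negf sum_divide_distrib power2_eq_square)
  finally show ?thesis by simp
qed

lemma nn_integral_gaussian_kernel: "(\<integral>\<^sup>+z. gaussian_kernel z \<partial>(lborel::'a::euclidean_space measure)) = 1"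
proof -
  interpret S: prob_space std_normal_distribution by (simp add: prob_space_normal_density)
  have "(\<integral>\<^sup>+z. gaussian_kernel z \<partial>(lborel::'a measure)) =
      (\<integral>\<^sup>+z. (\<Prod>b\<in>Basis. ennreal (std_normal_density (z \<bullet> b))) \<partial>(lborel::'a measure))"
    by (simp add: gaussian_kernel_def prod_ennreal)
  also have "\<dots> = (\<Prod>b\<in>(Basis::'a set). \<integral>\<^sup>+x. std_normal_density x \<partial>lborel)"
    by (subst nn_integral_lborel_prod) auto
  also have "(\<integral>\<^sup>+x. std_normal_density x \<partial>lborel) = 1"
    using S.emeasure_space_1 by (simp add: emeasure_density)
  finally show ?thesis by simp
qed

text \<open>By Fubini, integrating \<open>mchar M\<close> against a standard Gaussian gives the convolution of
  \<open>M\<close> with the Gaussian kernel.\<close>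

lemma nn_integral_gaussian_kernel_cong:
  fixes M N :: "'a::euclidean_space measure"
  assumes "prob_space M" "sets M = sets borel" "prob_space N" "sets N = sets borel"
    and eq: "mchar M = mchar N"
  shows "(\<integral>\<^sup>+x. gaussian_kernel (c *\<^sub>R (y - x)) \<partial>M) = (\<integral>\<^sup>+x. gaussian_kernel (c *\<^sub>R (y - x)) \<partial>N)"
proof -
  \<comment> \<open>G is the standard Gaussian. Its characteristic function is the kernel divided by
    K, so the kernel can be replaced by an integral of exponentials, and no Fourier inversion is
    needed.\<close>
  obtain G :: "'a measure" where G: "prob_space G" "sets G = sets borel"
    and charG: "\<And>h. mchar G h = exp (- complex_of_real (h \<bullet> h / 2))"
    using ex_measure_mchar_gaussian[of "\<lambda>x. x" 0] by (auto simp: linear_id[unfolded id_def])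
  define K where "K = (1 / sqrt (2 * pi)) ^ DIM('a)"
  have conv: "complex_of_real (\<integral>x. gaussian_kernel (c *\<^sub>R (y - x)) \<partial>L) =
      K * (CLINT z|G. iexp (- (c * (z \<bullet> y))) * mchar L (c *\<^sub>R z))"
    and int: "integrable L (\<lambda>x. gaussian_kernel (c *\<^sub>R (y - x)))"
    if L: "prob_space L" "sets L = sets borel" for L :: "'a measure"
  proof -
    interpret G: prob_space G by fact
    interpret L: prob_space L by fact
    interpret P: pair_prob_space L G ..
    have [measurable_cong]: "sets L = sets borel" "sets G = sets borel" by fact+
    have m: "integrable (L \<Otimes>\<^sub>M G) (\<lambda>p. iexp (snd p \<bullet> (c *\<^sub>R (fst p - y))))"
      by (rule P.integrable_iexp) auto
    have b: "gaussian_kernel (c *\<^sub>R (y - x)) = K * exp (- ((c *\<^sub>R (x - y)) \<bullet> (c *\<^sub>R (x - y))) / 2)" for x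
      by (simp add: gaussian_kernel_eq K_def norm_minus_commute flip: power2_norm_eq_inner)
    show "integrable L (\<lambda>x. gaussian_kernel (c *\<^sub>R (y - x)))"
      unfolding b
      by (intro integrable_mult_right L.integrable_const_bound[where B=1])
        (auto simp del: inner_scaleR_left inner_scaleR_right)
    have "complex_of_real (\<integral>x. gaussian_kernel (c *\<^sub>R (y - x)) \<partial>L) =
        (CLINT x|L. K * mchar G (c *\<^sub>R (x - y)))"
      unfolding integral_complex_of_real[symmetric]
      by (rule Bochner_Integration.integral_cong) (simp_all add: b charG flip: exp_of_real)
    also have "\<dots> = K * (CLINT x|L. CLINT z|G. iexp (z \<bullet> (c *\<^sub>R (x - y))))"
      by (simp add: mchar_def)
    also have "(CLINT x|L. CLINT z|G. iexp (z \<bullet> (c *\<^sub>R (x - y)))) =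
        (CLINT z|G. CLINT x|L. iexp (z \<bullet> (c *\<^sub>R (x - y))))"
      by (rule P.Fubini_integral[symmetric]) (use m in \<open>simp add: case_prod_unfold\<close>)
    also have "\<dots> = (CLINT z|G. CLINT x|L. iexp (- (c * (z \<bullet> y))) * iexp (x \<bullet> (c *\<^sub>R z)))"
      by (intro Bochner_Integration.integral_cong)
        (auto simp: mult_exp_exp algebra_simps inner_diff_right inner_commute)
    also have "\<dots> = (CLINT z|G. iexp (- (c * (z \<bullet> y))) * mchar L (c *\<^sub>R z))"
      by (simp add: mchar_def)
    finally show "complex_of_real (\<integral>x. gaussian_kernel (c *\<^sub>R (y - x)) \<partial>L) =
      K * (CLINT z|G. iexp (- (c * (z \<bullet> y))) * mchar L (c *\<^sub>R z))" .
  qed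
  have "complex_of_real (\<integral>x. gaussian_kernel (c *\<^sub>R (y - x)) \<partial>M) = complex_of_real (\<integral>x. gaussian_kernel (c *\<^sub>R (y - x)) \<partial>N)"
    unfolding conv[OF assms(1,2)] conv[OF assms(3,4)] eq ..
  then show ?thesis
    using int[OF assms(1,2)] int[OF assms(3,4)]
    by (simp add: nn_integral_eq_integral gaussian_kernel_nonneg)
qed

text \<open>Gaussians of scale 1/(k+1) form an approximate identity. Dominated convergence is used
  twice: in z with the kernel as majorant, then in x with the constant 1.\<close>

lemma tendsto_smoothing:
  fixes M :: "'a::euclidean_space measure" and \<phi> :: "'a \<Rightarrow> real"
  assumes "prob_space M" "sets M = sets borel"
    and \<phi>: "continuous_on UNIV \<phi>" "\<And>x. 0 \<le> \<phi> x" "\<And>x. \<phi> x \<le> 1"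
  shows "(\<lambda>k. \<integral>\<^sup>+x. (\<integral>\<^sup>+z. ennreal (\<phi> (x + z /\<^sub>R real (Suc k))) * gaussian_kernel z \<partial>lborel) \<partial>M)
    \<longlonglongrightarrow> (\<integral>\<^sup>+x. \<phi> x \<partial>M)"
proof -
  interpret prob_space M by fact
  have [measurable_cong]: "sets M = sets borel" by fact
  have [measurable]: "\<phi> \<in> borel_measurable borel" using \<phi>(1) by (rule borel_measurable_continuous_onI)
  have le: "ennreal (\<phi> (x + z /\<^sub>R real (Suc k))) * gaussian_kernel z \<le> gaussian_kernel z" for x z k
    using mult_right_mono[of "ennreal (\<phi> (x + z /\<^sub>R real (Suc k)))" 1 "gaussian_kernel z"] \<phi>(3) by simp
  have lim: "(\<lambda>k. \<integral>\<^sup>+z. ennreal (\<phi> (x + z /\<^sub>R real (Suc k))) * gaussian_kernel z \<partial>lborel) \<longlonglongrightarrow> \<phi> x" for x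
  proof -
    have "(\<lambda>k. \<integral>\<^sup>+z. ennreal (\<phi> (x + z /\<^sub>R real (Suc k))) * gaussian_kernel z \<partial>lborel)
        \<longlonglongrightarrow> (\<integral>\<^sup>+z. ennreal (\<phi> x) * gaussian_kernel z \<partial>(lborel::'a measure))"
    proof (rule nn_integral_dominated_convergence[where w=gaussian_kernel])
      have "(\<lambda>k. \<phi> (x + z /\<^sub>R real (Suc k))) \<longlonglongrightarrow> \<phi> (x + 0 *\<^sub>R z)" for z
      proof (rule continuous_on_tendsto_compose[OF \<phi>(1)])
        show "(\<lambda>k. x + z /\<^sub>R real (Suc k)) \<longlonglongrightarrow> x + 0 *\<^sub>R z"
          by (intro tendsto_intros LIMSEQ_inverse_real_of_nat)
      qed auto
      then have "(\<lambda>k. ennreal (\<phi> (x + z /\<^sub>R real (Suc k))) * gaussian_kernel z) \<longlonglongrightarrow> ennreal (\<phi> x) * gaussian_kernel z" for z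
        unfolding ennreal_mult''[OF gaussian_kernel_nonneg, symmetric]
        by (intro tendsto_ennrealI tendsto_mult tendsto_const) simp
      then show "AE z in lborel. (\<lambda>k. ennreal (\<phi> (x + z /\<^sub>R real (Suc k))) * gaussian_kernel z) \<longlonglongrightarrow> ennreal (\<phi> x) * gaussian_kernel z"
        by simp
    qed (use le in \<open>auto simp: nn_integral_gaussian_kernel\<close>)
    then show ?thesis by (simp add: nn_integral_cmult nn_integral_gaussian_kernel)
  qed
  show ?thesis
  proof (rule nn_integral_dominated_convergence[where w="\<lambda>_. 1"])
    have "(\<integral>\<^sup>+z. ennreal (\<phi> (x + z /\<^sub>R real (Suc k))) * gaussian_kernel z \<partial>lborel) \<le> (\<integral>\<^sup>+z. gaussian_kernel z \<partial>(lborel::'a measure))" for x k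
      by (intro nn_integral_mono le)
    then show "AE x in M. (\<integral>\<^sup>+z. ennreal (\<phi> (x + z /\<^sub>R real (Suc k))) * gaussian_kernel z \<partial>lborel) \<le> 1" for k
      by (simp add: nn_integral_gaussian_kernel)
  qed (use lim emeasure_space_1 in auto)
qed

text \<open>The substitution z = c (y - x), with Jacobian c^n in dimension n, and Fubini confine M
  to the inner kernel integral, which by \<open>nn_integral_gaussian_kernel_cong\<close> depends on
  \<open>mchar M\<close> alone.\<close>

lemma nn_integral_smoothing:
  fixes M :: "'a::euclidean_space measure" and \<phi> :: "'a \<Rightarrow> real"
  assumes "prob_space M" "sets M = sets borel" and [measurable]: "\<phi> \<in> borel_measurable borel"
    and "c > 0"
  shows "(\<integral>\<^sup>+x. (\<integral>\<^sup>+z. ennreal (\<phi> (x + z /\<^sub>R c)) * gaussian_kernel z \<partial>lborel) \<partial>M) =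
    (\<integral>\<^sup>+y. c ^ DIM('a) * \<phi> y * (\<integral>\<^sup>+x. gaussian_kernel (c *\<^sub>R (y - x)) \<partial>M) \<partial>lborel)"
proof -
  interpret prob_space M by fact
  interpret pair_sigma_finite M "lborel::'a measure" ..
  have [measurable_cong]: "sets M = sets borel" by fact
  have "(\<integral>\<^sup>+z. ennreal (\<phi> (x + z /\<^sub>R c)) * gaussian_kernel z \<partial>lborel) =
      (\<integral>\<^sup>+y. (c ^ DIM('a) * \<phi> y) * ennreal (gaussian_kernel (c *\<^sub>R (y - x))) \<partial>lborel)" for x
  proof -
    have "- (c *\<^sub>R x) + c *\<^sub>R y = c *\<^sub>R (y - x)" for y by (simp add: algebra_simps)
    then show ?thesis
      using \<open>c > 0\<close>
      by (subst lborel_affine[of c "- (c *\<^sub>R x)"])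
        (auto simp: nn_integral_density nn_integral_distr scaleR_diff_right ennreal_mult' mult.assoc intro!: nn_integral_cong)
  qed
  then have "(\<integral>\<^sup>+x. (\<integral>\<^sup>+z. ennreal (\<phi> (x + z /\<^sub>R c)) * gaussian_kernel z \<partial>lborel) \<partial>M) =
      (\<integral>\<^sup>+x. \<integral>\<^sup>+y. (c ^ DIM('a) * \<phi> y) * ennreal (gaussian_kernel (c *\<^sub>R (y - x))) \<partial>lborel \<partial>M)" by simp
  also have "\<dots> = (\<integral>\<^sup>+y. \<integral>\<^sup>+x. (c ^ DIM('a) * \<phi> y) * ennreal (gaussian_kernel (c *\<^sub>R (y - x))) \<partial>M \<partial>lborel)"
    by (rule Fubini'[symmetric]) simp
  also have "\<dots> = (\<integral>\<^sup>+y. c ^ DIM('a) * \<phi> y * (\<integral>\<^sup>+x. gaussian_kernel (c *\<^sub>R (y - x)) \<partial>M) \<partial>lborel)"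
    by (simp add: nn_integral_cmult)
  finally show ?thesis .
qed

text \<open>Equal characteristic functions give equal smoothed integrals at every scale; letting the
  scale tend to 0 removes the smoothing.\<close>

theorem mchar_uniqueness:
  fixes M N :: "'a::euclidean_space measure"
  assumes "prob_space M" "sets M = sets borel" "prob_space N" "sets N = sets borel"
    and "mchar M = mchar N"
  shows "M = N"
proof (rule measure_eqI_nn_integral_continuous[OF assms(1-4)])
  fix \<phi> :: "'a \<Rightarrow> real"
  assume \<phi>: "continuous_on UNIV \<phi>" "\<And>x. 0 \<le> \<phi> x" "\<And>x. \<phi> x \<le> 1"
  have [measurable]: "\<phi> \<in> borel_measurable borel" using \<phi>(1) by (rule borel_measurable_continuous_onI)
  have eq: "(\<integral>\<^sup>+x. (\<integral>\<^sup>+z. ennreal (\<phi> (x + z /\<^sub>R real (Suc k))) * gaussian_kernel z \<partial>lborel) \<partial>M) =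
    (\<integral>\<^sup>+x. (\<integral>\<^sup>+z. ennreal (\<phi> (x + z /\<^sub>R real (Suc k))) * gaussian_kernel z \<partial>lborel) \<partial>N)" for k
    by (simp only: nn_integral_smoothing[OF assms(1,2)] nn_integral_smoothing[OF assms(3,4)]
        nn_integral_gaussian_kernel_cong[OF assms] \<open>\<phi> \<in> borel_measurable borel\<close> of_nat_0_less_iff zero_less_Suc)
  show "(\<integral>\<^sup>+x. \<phi> x \<partial>M) = (\<integral>\<^sup>+x. \<phi> x \<partial>N)"
    using tendsto_smoothing[OF assms(1,2) \<phi>, unfolded eq] tendsto_smoothing[OF assms(3,4) \<phi>]
    by (rule LIMSEQ_unique)
qed

subsection \<open>Gaussian measures with given mean and covariance\<close>

text \<open>Symmetry is part of the notion because \<open>gaussian_char\<close> sees only the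
  quadratic form, while \<open>gaussian\<close> prescribes the bilinear form; polarisation recovers
  the latter for symmetric Q.\<close>

definition psd_matrix :: "real^'n^'n \<Rightarrow> bool" where
  "psd_matrix Q \<longleftrightarrow> transpose Q = Q \<and> (\<forall>x. (Q *v x) \<bullet> x \<ge> 0)"

definition gaussian_char :: "real^'n \<Rightarrow> real^'n^'n \<Rightarrow> real^'n \<Rightarrow> complex" where
  "gaussian_char m Q h = iexp (m \<bullet> h) * exp (- complex_of_real ((Q *v h) \<bullet> h / 2))"

lemma inner_transpose_mult: "x \<bullet> (transpose A *v y) = (A *v x) \<bullet> (y :: real^'m)" for A :: "real^'n^'m"
  by (metis dot_lmul_matrix inner_commute vector_transpose_matrix transpose_transpose)

lemma moments_gaussian_marginal:
  fixes M :: "(real^'n) measure"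
  assumes "sets M = sets borel" "distr M borel (\<lambda>x. x \<bullet> h) = gaussian1 a \<sigma>" "\<sigma> \<ge> 0"
  shows "has_bochner_integral M (\<lambda>x. x \<bullet> h) a"
    and "has_bochner_integral M (\<lambda>x. (x \<bullet> h - a)\<^sup>2) (\<sigma>\<^sup>2)"
proof -
  have [measurable_cong]: "sets M = sets borel" by fact
  show "has_bochner_integral M (\<lambda>x. x \<bullet> h) a"
    using gaussian1_moments(1)[OF assms(3), of a]
    unfolding assms(2)[symmetric] by (simp add: has_bochner_integral_iff integrable_distr_eq integral_distr)
  show "has_bochner_integral M (\<lambda>x. (x \<bullet> h - a)\<^sup>2) (\<sigma>\<^sup>2)"
    using gaussian1_moments(2)[OF assms(3), of a]
    unfolding assms(2)[symmetric] by (simp add: has_bochner_integral_iff integrable_distr_eq integral_distr)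
qed

lemma integrable_gaussian_measure:
  fixes M :: "(real^'n) measure"
  assumes "gaussian_measure M"
  shows "integrable M (\<lambda>x. x)"
proof -
  have "integrable M (\<lambda>x. x \<bullet> b)" for b
    using assms moments_gaussian_marginal(1) unfolding gaussian_measure_def
    by (metis has_bochner_integral_iff)
  then have "integrable M (\<lambda>x. \<Sum>b\<in>Basis. (x \<bullet> b) *\<^sub>R b)" by auto
  then show ?thesis by (simp add: euclidean_representation)
qed

text \<open>Uniqueness half of the definite description: the two parameters of the marginal along h
  are forced by the prescribed first and second moments.\<close>

lemma mchar_gaussian_measure:
  fixes M :: "(real^'n) measure"
  assumes M: "gaussian_measure M" and m: "(\<integral>x. x \<partial>M) = m"
    and Q: "\<And>h k. (\<integral>x. ((x - m) \<bullet> h) * ((x - m) \<bullet> k) \<partial>M) = (Q *v h) \<bullet> k"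
  shows "mchar M h = gaussian_char m Q h"
proof -
  have S: "sets M = sets borel" using M by (simp add: gaussian_measure_def)
  obtain a \<sigma> where \<sigma>: "\<sigma> \<ge> 0" "distr M borel (\<lambda>x. x \<bullet> h) = gaussian1 a \<sigma>"
    using M unfolding gaussian_measure_def by metis
  note mom = moments_gaussian_marginal[OF S \<sigma>(2,1)]
  have a: "a = m \<bullet> h"
    using mom(1) integrable_gaussian_measure[OF M]
    by (cases "h = 0") (auto simp: has_bochner_integral_iff m)
  have "\<sigma>\<^sup>2 = (Q *v h) \<bullet> h"
    using mom(2) Q[of h h] by (simp add: has_bochner_integral_iff a inner_diff_left power2_eq_square)
  then show ?thesis
    using char_distr_inner[OF S, of h 1] char_gaussian1[OF \<sigma>(1), of a 1]
    by (simp add: \<sigma> a gaussian_char_def)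
qed

text \<open>Existence half: along each line the characteristic function is that of a one-dimensional
  Gaussian, so the marginals, and with them all moments up to order two, are known.\<close>

lemma gaussian_measure_if_mchar:
  fixes M :: "(real^'n) measure"
  assumes "prob_space M" and S: "sets M = sets borel" and Q: "psd_matrix Q"
    and char: "\<And>h. mchar M h = gaussian_char m Q h"
  shows "gaussian_measure M" "(\<integral>x. x \<partial>M) = m"
    "(\<integral>x. ((x - m) \<bullet> h) * ((x - m) \<bullet> k) \<partial>M) = (Q *v h) \<bullet> k"
proof -
  interpret prob_space M by fact
  have [measurable_cong]: "sets M = sets borel" by fact
  have marg: "distr M borel (\<lambda>x. x \<bullet> h) = gaussian1 (m \<bullet> h) (sqrt ((Q *v h) \<bullet> h))"
    and pos: "sqrt ((Q *v h) \<bullet> h) \<ge> 0" for h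
  proof -
    show pos: "sqrt ((Q *v h) \<bullet> h) \<ge> 0" using Q by (simp add: psd_matrix_def)
    have "prob_space (distr M borel (\<lambda>x. x \<bullet> h))" by (rule prob_space_distr) simp
    then have "real_distribution (distr M borel (\<lambda>x. x \<bullet> h))"
      by (simp add: real_distribution_def real_distribution_axioms_def)
    moreover have "char (distr M borel (\<lambda>x. x \<bullet> h)) t = char (gaussian1 (m \<bullet> h) (sqrt ((Q *v h) \<bullet> h))) t" for t
    proof -
      have "(t * sqrt ((Q *v h) \<bullet> h))\<^sup>2 = (Q *v (t *\<^sub>R h)) \<bullet> (t *\<^sub>R h)"
        using pos by (simp add: power_mult_distrib power2_eq_square matrix_vector_mult_scaleR)
      then show ?thesis
        unfolding char_distr_inner[OF S] char char_gaussian1[OF pos] gaussian_char_def by simp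
    qed
    ultimately show "distr M borel (\<lambda>x. x \<bullet> h) = gaussian1 (m \<bullet> h) (sqrt ((Q *v h) \<bullet> h))"
      by (intro Levy_uniqueness real_distribution_gaussian1 pos ext)
  qed
  show G: "gaussian_measure M"
    unfolding gaussian_measure_def using assms(1,2) marg pos by blast
  note mom = moments_gaussian_marginal[OF S marg pos]
  have "(\<integral>x. x \<partial>M) \<bullet> b = m \<bullet> b" for b
    using mom(1)[of b] integrable_gaussian_measure[OF G]
    by (cases "b = 0") (auto simp: has_bochner_integral_iff)
  then show "(\<integral>x. x \<partial>M) = m" by (metis vector_eq_rdot)
  have sq: "has_bochner_integral M (\<lambda>x. ((x - m) \<bullet> h)\<^sup>2) ((Q *v h) \<bullet> h)" for h
    using mom(2)[of h] pos[of h] by (simp add: inner_diff_left)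
  \<comment> \<open>Polarisation, 2ab = (a+b)^2 - a^2 - b^2, applied to the integrand and to the
    form of Q; the latter uses symmetry.\<close>
  have "has_bochner_integral M
      (\<lambda>x. (((x - m) \<bullet> (h + k))\<^sup>2 - ((x - m) \<bullet> h)\<^sup>2 - ((x - m) \<bullet> k)\<^sup>2) / 2)
      (((Q *v (h + k)) \<bullet> (h + k) - (Q *v h) \<bullet> h - (Q *v k) \<bullet> k) / 2)"
    by (intro has_bochner_integral_divide_zero has_bochner_integral_diff sq)
  moreover have "(((x - m) \<bullet> (h + k))\<^sup>2 - ((x - m) \<bullet> h)\<^sup>2 - ((x - m) \<bullet> k)\<^sup>2) / 2 =
      ((x - m) \<bullet> h) * ((x - m) \<bullet> k)" for x
    by (simp add: inner_add_right power2_sum)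
  moreover have "(Q *v k) \<bullet> h = (Q *v h) \<bullet> k"
    using Q inner_transpose_mult[of h Q k] by (simp add: psd_matrix_def inner_commute)
  then have "((Q *v (h + k)) \<bullet> (h + k) - (Q *v h) \<bullet> h - (Q *v k) \<bullet> k) / 2 = (Q *v h) \<bullet> k"
    by (simp add: inner_add_right inner_add_left matrix_vector_right_distrib)
  ultimately show "(\<integral>x. ((x - m) \<bullet> h) * ((x - m) \<bullet> k) \<partial>M) = (Q *v h) \<bullet> k"
    by (simp add: has_bochner_integral_iff)
qed

text \<open>Resolves the definite description once and for all; from here on Gaussian measures are
  handled through characteristic functions.\<close>

lemma gaussian_eqI:
  fixes M :: "(real^'n) measure"
  assumes "prob_space M" "sets M = sets borel" "psd_matrix Q"
    and "\<And>h. mchar M h = gaussian_char m Q h"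
  shows "M = gaussian m Q"
  unfolding gaussian_def
proof (rule the_equality[symmetric], intro conjI allI gaussian_measure_if_mchar[OF assms])
  fix N
  assume N: "gaussian_measure N \<and> (\<integral>x. x \<partial>N) = m \<and>
    (\<forall>h k. (\<integral>x. ((x - m) \<bullet> h) * ((x - m) \<bullet> k) \<partial>N) = (Q *v h) \<bullet> k)"
  then have "prob_space N" "sets N = sets borel" by (auto simp: gaussian_measure_def)
  moreover have "mchar N = mchar M"
    using mchar_gaussian_measure[of N m Q] N assms(4) by auto
  ultimately show "N = M" using assms(1,2) by (intro mchar_uniqueness)
qed

lemma gaussian_properties:
  assumes "psd_matrix Q"
  shows "prob_space (gaussian m Q)" "sets (gaussian m Q) = sets borel"
    "mchar (gaussian m Q) h = gaussian_char m Q h"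
proof -
  obtain M where M: "prob_space M" "sets M = sets borel" "\<And>h. mchar M h = gaussian_char m Q h"
    using ex_measure_mchar_gaussian[of "(*v) Q" m] assms inner_transpose_mult[of _ Q]
    unfolding psd_matrix_def gaussian_char_def by auto
  with gaussian_eqI[OF M(1,2) assms M(3)] show "prob_space (gaussian m Q)"
    "sets (gaussian m Q) = sets borel" "mchar (gaussian m Q) h = gaussian_char m Q h" by auto
qed

subsection \<open>Evolution families\<close>

text \<open>The squared norm of V times exp (c t) is monotone, with c = -2K to the right of s and c
  = 2K to the left, so moving away from s in either direction cannot raise it above its value 0 at
  s.\<close>

lemma gronwall_zero:
  fixes V :: "real \<Rightarrow> 'a::real_inner"
  assumes V: "\<And>t. (V has_vector_derivative V' t) (at t)"
    and bd: "\<And>t. norm (V' t) \<le> K * norm (V t)" and zero: "V s = 0"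
  shows "V t = 0"
proof -
  have D: "((\<lambda>t. exp (c * t) * (V t \<bullet> V t)) has_real_derivative
      exp (c * t) * (c * (V t \<bullet> V t) + 2 * (V t \<bullet> V' t))) (at t)" for c t
  proof -
    have "((\<lambda>t. V t \<bullet> V t) has_vector_derivative V t \<bullet> V' t + V' t \<bullet> V t) (at t)"
      by (rule bounded_bilinear.has_vector_derivative[OF bounded_bilinear_inner V V])
    then have "((\<lambda>t. V t \<bullet> V t) has_real_derivative V t \<bullet> V' t + V' t \<bullet> V t) (at t)"
      by (simp add: has_real_derivative_iff_has_vector_derivative)
    then show ?thesis
      by (auto intro!: derivative_eq_intros simp: algebra_simps inner_commute)
  qed
  have le: "\<bar>V t \<bullet> V' t\<bar> \<le> K * (V t \<bullet> V t)" for t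
  proof -
    have "\<bar>V t \<bullet> V' t\<bar> \<le> norm (V t) * norm (V' t)" by (rule Cauchy_Schwarz_ineq2)
    also have "\<dots> \<le> norm (V t) * (K * norm (V t))" by (intro mult_left_mono bd) auto
    finally show ?thesis by (simp add: power2_norm_eq_inner[symmetric] power2_eq_square algebra_simps)
  qed
  have "exp (c * t) * (V t \<bullet> V t) \<le> exp (c * s) * (V s \<bullet> V s)"
    if "c = (if s \<le> t then - 2 * K else 2 * K)" for c
  proof (cases "s \<le> t")
    case True
    show ?thesis
    proof (rule DERIV_nonpos_imp_nonincreasing[OF True])
      fix x
      have "c * (V x \<bullet> V x) + 2 * (V x \<bullet> V' x) \<le> 0" using le[of x] True that by auto
      then show "\<exists>y. DERIV (\<lambda>t. exp (c * t) * (V t \<bullet> V t)) x :> y \<and> y \<le> 0"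
        using D[of c x] by (intro exI[of _ "exp (c * x) * (c * (V x \<bullet> V x) + 2 * (V x \<bullet> V' x))"])
          (auto intro: mult_nonneg_nonpos)
    qed
  next
    case False
    show ?thesis
    proof (rule DERIV_nonneg_imp_nondecreasing[of t s])
      fix x
      have "c * (V x \<bullet> V x) + 2 * (V x \<bullet> V' x) \<ge> 0" using le[of x] False that by auto
      then show "\<exists>y. DERIV (\<lambda>t. exp (c * t) * (V t \<bullet> V t)) x :> y \<and> 0 \<le> y"
        using D[of c x] by (intro exI[of _ "exp (c * x) * (c * (V x \<bullet> V x) + 2 * (V x \<bullet> V' x))"])
          auto
    qed (use False in simp)
  qed
  then have "exp (c * t) * (V t \<bullet> V t) \<le> 0"
    if "c = (if s \<le> t then - 2 * K else 2 * K)" for c using that zero by simp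
  then show ?thesis by (auto simp: mult_le_0_iff simp flip: power2_norm_eq_inner)
qed

lemma bounded_bilinear_matrix_mult:
  "bounded_bilinear ((**) :: real^'m^'n \<Rightarrow> real^'k^'m \<Rightarrow> real^'k^'n)"
  by (subst bilinear_conv_bounded_bilinear[symmetric])
    (auto simp: bilinear_def vec_eq_iff matrix_matrix_mult_def sum.distrib sum_distrib_left
      algebra_simps intro!: linearI)

lemma bounded_bilinear_matrix_vector_mult:
  "bounded_bilinear ((*v) :: real^'m^'n \<Rightarrow> real^'m \<Rightarrow> real^'n)"
  by (subst bilinear_conv_bounded_bilinear[symmetric])
    (auto simp: bilinear_def matrix_vector_mult_add_rdistrib scaleR_matrix_vector_assoc[symmetric] intro!: linearI)

lemma bounded_linear_transpose: "bounded_linear (transpose :: real^'m^'n \<Rightarrow> real^'n^'m)"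
  by (subst linear_conv_bounded_linear[symmetric])
    (auto simp: transpose_def vec_eq_iff intro!: linearI)

text \<open>Transfers the growth bound, phrased with \<open>onorm\<close>, to the norm of the matrix
  type. The crude factor counts the entries, each at most the operator norm.\<close>

lemma norm_matrix_le_onorm:
  fixes A :: "real^'n^'n"
  shows "norm A \<le> real (CARD('n) * CARD('n)) * onorm ((*v) A)"
proof -
  have "norm A \<le> (\<Sum>i\<in>UNIV. norm (A $ i))" by (simp add: norm_vec_def L2_set_le_sum)
  also have "\<dots> \<le> (\<Sum>i\<in>UNIV. \<Sum>j\<in>UNIV. \<bar>A $ i $ j\<bar>)"
    by (intro sum_mono norm_le_l1_cart)
  also have "\<dots> \<le> (\<Sum>i\<in>(UNIV::'n set). \<Sum>j\<in>(UNIV::'n set). onorm ((*v) A))"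
    by (intro sum_mono matrix_component_le_onorm)
  finally show ?thesis by simp
qed

text \<open>As functions of t both sides solve V' = A V and agree at t = s, so Gronwall applies to
  their difference.\<close>

lemma evolution_family_cocycle:
  fixes U :: "real \<Rightarrow> real \<Rightarrow> real^'n^'n"
  assumes U: "evolution_family A U" and "bounded (range A)"
  shows "U t s ** U s r = U t r"
proof -
  obtain a where a: "\<And>t. norm (A t) \<le> a" using assms(2) by (auto simp: bounded_iff)
  obtain K where K: "K > 0" "\<And>(X :: real^'n^'n) (Y :: real^'n^'n). norm (X ** Y) \<le> norm X * norm Y * K"
    using bounded_bilinear.pos_bounded[OF bounded_bilinear_matrix_mult] by blast
  define V where "V t = U t s ** U s r - U t r" for t
  have D: "((\<lambda>\<tau>. U \<tau> s) has_vector_derivative (A t ** U t s)) (at t)" for t s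
    using U by (simp add: evolution_family_def)
  have "(V has_vector_derivative A t ** V t) (at t)" for t
  proof -
    have "((\<lambda>t. U t s ** U s r - U t r) has_vector_derivative (A t ** U t s) ** U s r - A t ** U t r) (at t)"
      by (intro has_vector_derivative_diff D bounded_linear.has_vector_derivative[OF
            bounded_bilinear.bounded_linear_left[OF bounded_bilinear_matrix_mult]])
    then show ?thesis by (simp add: V_def[abs_def] matrix_mul_assoc
          bounded_bilinear.diff_right[OF bounded_bilinear_matrix_mult])
  qed
  moreover have "norm (A t ** V t) \<le> (a * K) * norm (V t)" for t
  proof -
    have "norm (A t ** V t) \<le> norm (A t) * norm (V t) * K" by (rule K)
    also have "\<dots> \<le> a * norm (V t) * K" using K(1) a by (intro mult_right_mono) auto
    finally show ?thesis by (simp add: mult_ac)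
  qed
  moreover have "V s = 0" using U by (simp add: V_def evolution_family_def)
  ultimately have "V t = 0" by (rule gronwall_zero)
  then show ?thesis by (simp add: V_def)
qed

lemma growth_bound_negativeE:
  fixes U :: "real \<Rightarrow> real \<Rightarrow> real^'n^'n"
  assumes "growth_bound U < 0"
  obtains C \<omega> where "\<omega> > 0" "C \<ge> 0" "\<And>s t. s \<le> t \<Longrightarrow> norm (U t s) \<le> C * exp (- \<omega> * (t - s))"
proof -
  obtain \<omega> M where \<omega>: "\<omega> < 0" and M: "\<And>s t. s \<le> t \<Longrightarrow> onorm ((*v) (U t s)) \<le> M * exp (\<omega> * (t - s))"
    using assms unfolding growth_bound_def Inf_less_iff by auto
  define n where "n = real (CARD('n) * CARD('n))"
  have "norm (U t s) \<le> (n * \<bar>M\<bar>) * exp (- (- \<omega>) * (t - s))" if "s \<le> t" for s t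
  proof -
    have "norm (U t s) \<le> n * onorm ((*v) (U t s))" unfolding n_def by (rule norm_matrix_le_onorm)
    also have "\<dots> \<le> n * (\<bar>M\<bar> * exp (\<omega> * (t - s)))"
      using order_trans[OF M[OF that], of "\<bar>M\<bar> * exp (\<omega> * (t - s))"]
      by (intro mult_left_mono) (auto simp: n_def)
    finally show ?thesis by simp
  qed
  then show ?thesis using \<omega> by (intro that[of "- \<omega>" "n * \<bar>M\<bar>"]) (auto simp: n_def)
qed

text \<open>\<open>evolution_family\<close> gives regularity in the first argument only. The cocycle
  law U(t,r) - U(t,r0) = U(t,r) (I - U(r,r0)) moves the increment there, and the decay estimate
  bounds U(t,r) by C.\<close>

lemma continuous_on_evolution_family_left:
  fixes U :: "real \<Rightarrow> real \<Rightarrow> real^'n^'n"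
  assumes U: "evolution_family A U" and "bounded (range A)"
    and \<omega>: "\<omega> > 0" "C \<ge> 0" "\<And>s t. s \<le> t \<Longrightarrow> norm (U t s) \<le> C * exp (- \<omega> * (t - s))"
  shows "continuous_on {..t} (U t)"
  unfolding continuous_on_def
proof safe
  fix r0 :: real assume "r0 \<le> t"
  obtain K where K: "K > 0" "\<And>(X :: real^'n^'n) (Y :: real^'n^'n). norm (X ** Y) \<le> norm X * norm Y * K"
    using bounded_bilinear.pos_bounded[OF bounded_bilinear_matrix_mult] by blast
  have C: "norm (U t r) \<le> C" if "r \<le> t" for r
  proof -
    have "norm (U t r) \<le> C * exp (- \<omega> * (t - r))" by (rule \<omega>(3)[OF that])
    also have "\<dots> \<le> C * 1" using \<omega> that by (intro mult_left_mono) auto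
    finally show ?thesis by simp
  qed
  have "((\<lambda>r. U r r0) has_vector_derivative A r0 ** U r0 r0) (at r0)"
    using U unfolding evolution_family_def by blast
  then have "isCont (\<lambda>r. U r r0) r0" by (rule has_vector_derivative_continuous)
  then have lim: "((\<lambda>r. U r r0) \<longlongrightarrow> mat 1) (at r0 within {..t})"
    using U by (auto simp: isCont_def evolution_family_def intro: tendsto_within_subset[OF _ subset_UNIV])
  have "((\<lambda>r. C * norm (mat 1 - U r r0) * K) \<longlongrightarrow> C * norm (mat 1 - mat 1 :: real^'n^'n) * K) (at r0 within {..t})"
    by (intro tendsto_intros lim)
  then have null: "((\<lambda>r. C * norm (mat 1 - U r r0) * K) \<longlongrightarrow> 0) (at r0 within {..t})" by simp
  have "norm (U t r - U t r0) \<le> C * norm (mat 1 - U r r0) * K" if "r \<le> t" for r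
  proof -
    have "U t r - U t r0 = U t r ** (mat 1 - U r r0)"
      using evolution_family_cocycle[OF assms(1,2), of t r r0] by (simp add:
          bounded_bilinear.diff_right[OF bounded_bilinear_matrix_mult])
    then have "norm (U t r - U t r0) \<le> norm (U t r) * norm (mat 1 - U r r0) * K" using K(2) by simp
    also have "\<dots> \<le> C * norm (mat 1 - U r r0) * K" using K(1) C[OF that] by (intro mult_right_mono) auto
    finally show ?thesis .
  qed
  then have "((\<lambda>r. U t r - U t r0) \<longlongrightarrow> 0) (at r0 within {..t})"
    by (intro Lim_null_comparison[OF _ null]) (auto simp: eventually_at_filter)
  then show "(U t \<longlongrightarrow> U t r0) (at r0 within {..t})" by (simp add: LIM_zero_iff)
qed

subsection \<open>Evolution systems of measures\<close>

text \<open>Up to the factor 1/\<omega> the integrand is the exponential density of rate \<omega>,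
  evaluated at t - r.\<close>

lemma set_integrable_exp_decay:
  assumes "\<omega> > (0::real)"
  shows "set_integrable lborel {..t} (\<lambda>r. exp (- \<omega> * (t - r)))"
proof -
  interpret prob_space "density lborel (exponential_density \<omega>)"
    by (rule prob_space_exponential_density) fact
  have "integrable (density lborel (exponential_density \<omega>)) (\<lambda>_. 1::real)" by simp
  then have "integrable lborel (exponential_density \<omega>)"
    using assms by (subst (asm) integrable_density) (auto simp: erlang_density_nonneg)
  then have "integrable lborel (\<lambda>r. (1 / \<omega>) * exponential_density \<omega> (t + (- 1) * r))"
    by (intro integrable_mult_right lborel_integrable_real_affine) auto
  also have "(\<lambda>r. (1 / \<omega>) * exponential_density \<omega> (t + (- 1) * r)) =
      (\<lambda>r. indicator {..t} r *\<^sub>R exp (- \<omega> * (t - r)))"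
    using assms by (auto simp: exponential_density_def fun_eq_iff algebra_simps split: split_indicator)
  finally show ?thesis by (simp add: set_integrable_def)
qed

lemma set_integrable_if_exp_decay:
  fixes h :: "real \<Rightarrow> 'a::euclidean_space"
  assumes "continuous_on {..t} h" "\<omega> > 0" "\<And>r. r \<le> t \<Longrightarrow> norm (h r) \<le> C * exp (- \<omega> * (t - r))"
  shows "set_integrable lborel {..t} h"
proof (rule set_integrable_bound)
  show "set_integrable lborel {..t} (\<lambda>r. C * exp (- \<omega> * (t - r)))"
    by (intro set_integrable_mult_right set_integrable_exp_decay assms)
  show "set_borel_measurable lborel {..t} h"
    unfolding set_borel_measurable_def
    using borel_measurable_continuous_on_indicator[OF _ assms(1)] by simp
  have "norm (h r) \<le> norm (C * exp (- \<omega> * (t - r)))" if "r \<le> t" for r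
    using assms(3)[OF that] by (simp only: real_norm_def)
  then show "AE r in lborel. r \<in> {..t} \<longrightarrow> norm (h r) \<le> norm (C * exp (- \<omega> * (t - r)))"
    by simp
qed

lemma tendsto_interval_integral_at_bot:
  fixes h :: "real \<Rightarrow> 'a::euclidean_space"
  assumes "set_integrable lborel {..t} h"
  shows "((\<lambda>s. LBINT r=ereal s..ereal t. h r) \<longlongrightarrow> (LBINT r=-\<infinity>..ereal t. h r)) at_bot"
proof -
  \<comment> \<open>The interval integral runs over the open interval, which misses only the null
    set {t}.\<close>
  have "(LBINT r=-\<infinity>..ereal t. h r) = (LBINT r:{..t}. h r)"
    unfolding interval_lebesgue_integral_def
    by (auto intro!: set_integral_discrete_difference[where X="{t}"])
  moreover have "((\<lambda>s. LBINT r:{s..t}. h r) \<longlongrightarrow> (LBINT r:{..t}. h r)) at_bot"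
    by (rule tendsto_set_lebesgue_integral_at_bot) (use assms in auto)
  moreover have "eventually (\<lambda>s. (LBINT r:{s..t}. h r) = (LBINT r=ereal s..ereal t. h r)) at_bot"
    using eventually_le_at_bot[of t] by eventually_elim (simp add: interval_integral_Icc)
  ultimately show ?thesis by (simp add: tendsto_cong)
qed

section \<open>Drift and covariance integrals\<close>

text \<open>Transposition and X \<mapsto> (X x) \<bullet> x are bounded linear, hence commute with
  the integral.\<close>

lemma psd_matrix_interval_integral:
  fixes H :: "real \<Rightarrow> real^'n^'n"
  assumes int: "set_integrable lborel {..t} H" and psd: "\<And>r. psd_matrix (H r)" and "s \<le> ereal t"
  shows "psd_matrix (LBINT r=s..ereal t. H r)"
proof -
  define S where "S = einterval s (ereal t)"
  have "set_integrable lborel S H"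
    by (rule set_integrable_subset[OF int]) (auto simp: S_def einterval_iff)
  then have int: "integrable lborel (\<lambda>r. indicator S r *\<^sub>R H r)" by (simp add: set_integrable_def)
  have I: "(LBINT r=s..ereal t. H r) = (\<integral>r. indicator S r *\<^sub>R H r \<partial>lborel)"
    using \<open>s \<le> ereal t\<close> by (simp add: interval_lebesgue_integral_def S_def set_lebesgue_integral_def)
  have "transpose (LBINT r=s..ereal t. H r) = (\<integral>r. transpose (indicator S r *\<^sub>R H r) \<partial>lborel)"
    unfolding I by (rule integral_bounded_linear[OF bounded_linear_transpose int, symmetric])
  also have "\<dots> = (LBINT r=s..ereal t. H r)"
    using psd unfolding I psd_matrix_def
    by (simp add: linear_scale[OF bounded_linear.linear[OF bounded_linear_transpose]])
  finally have sym: "transpose (LBINT r=s..ereal t. H r) = (LBINT r=s..ereal t. H r)" .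
  have "((LBINT r=s..ereal t. H r) *v x) \<bullet> x \<ge> 0" for x
  proof -
    have "bounded_linear (\<lambda>X :: real^'n^'n. (X *v x) \<bullet> x)"
      by (rule bounded_linear_compose[OF bounded_linear_inner_left
            bounded_bilinear.bounded_linear_left[OF bounded_bilinear_matrix_vector_mult]])
    from integral_bounded_linear[OF this int]
    have "((LBINT r=s..ereal t. H r) *v x) \<bullet> x = (\<integral>r. ((indicator S r *\<^sub>R H r) *v x) \<bullet> x \<partial>lborel)"
      unfolding I by simp
    also have "\<dots> \<ge> 0"
      using psd by (intro Bochner_Integration.integral_nonneg)
        (auto simp: psd_matrix_def simp flip: scaleR_matrix_vector_assoc)
    finally show ?thesis .
  qed
  with sym show ?thesis by (simp add: psd_matrix_def)
qed

lemma psd_matrix_mult_transpose: "psd_matrix (X ** transpose X)" for X :: "real^'n^'n"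
proof -
  have "((X ** transpose X) *v x) \<bullet> x = (transpose X *v x) \<bullet> (transpose X *v x)" for x
    by (simp only: inner_transpose_mult matrix_vector_mul_assoc[symmetric])
  then show ?thesis by (simp add: psd_matrix_def matrix_transpose_mul)
qed

text \<open>The form X X^T with X = U B shows positivity and reduces the norm estimate to one for
  X.\<close>

lemma covariance_integrand_eq:
  fixes U :: "real \<Rightarrow> real \<Rightarrow> real^'n^'n" and B :: "real \<Rightarrow> real^'n^'n"
  shows "U t r ** B r ** transpose (B r) ** transpose (U t r) = (U t r ** B r) ** transpose (U t r ** B r)"
  by (simp add: matrix_transpose_mul matrix_mul_assoc)

lemma set_integrable_drift:
  fixes U :: "real \<Rightarrow> real \<Rightarrow> real^'n^'n" and f :: "real \<Rightarrow> real^'n"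
  assumes "continuous_on {..t} (U t)" and "\<omega> > 0"
    and U: "\<And>r. r \<le> t \<Longrightarrow> norm (U t r) \<le> C * exp (- \<omega> * (t - r))"
    and f: "continuous_on UNIV f" "bounded (range f)"
  shows "set_integrable lborel {..t} (\<lambda>r. U t r *v f r)"
proof -
  obtain K where K: "K > 0" "\<And>(X :: real^'n^'n) (y :: real^'n). norm (X *v y) \<le> norm X * norm y * K"
    using bounded_bilinear.pos_bounded[OF bounded_bilinear_matrix_vector_mult] by blast
  obtain F where F: "\<And>r. norm (f r) \<le> F" using f(2) by (auto simp: bounded_iff)
  then have "F \<ge> 0" using norm_ge_zero order_trans by blast
  have "norm (U t r *v f r) \<le> (C * F * K) * exp (- \<omega> * (t - r))" if "r \<le> t" for r
  proof -
    have "norm (U t r *v f r) \<le> norm (U t r) * norm (f r) * K" by (rule K)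
    also have "\<dots> \<le> (C * exp (- \<omega> * (t - r))) * F * K"
      using K(1) \<open>F \<ge> 0\<close> order_trans[OF norm_ge_zero U[OF that]]
      by (intro mult_right_mono mult_mono U F that) auto
    finally show ?thesis by (simp add: mult_ac)
  qed
  moreover have "continuous_on {..t} (\<lambda>r. U t r *v f r)"
    by (intro bounded_bilinear.continuous_on[OF bounded_bilinear_matrix_vector_mult] assms
        continuous_on_subset[OF f(1)]) auto
  ultimately show ?thesis using \<open>\<omega> > 0\<close> by (intro set_integrable_if_exp_decay)
qed

lemma set_integrable_covar:
  fixes U :: "real \<Rightarrow> real \<Rightarrow> real^'n^'n" and B :: "real \<Rightarrow> real^'n^'n"
  assumes cont: "continuous_on {..t} (U t)" and "\<omega> > 0"
    and U: "\<And>r. r \<le> t \<Longrightarrow> norm (U t r) \<le> C * exp (- \<omega> * (t - r))"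
    and B: "continuous_on UNIV B" "bounded (range B)"
  shows "set_integrable lborel {..t} (\<lambda>r. U t r ** B r ** transpose (B r) ** transpose (U t r))"
proof -
  obtain K where K: "K > 0" "\<And>(X :: real^'n^'n) (Y :: real^'n^'n). norm (X ** Y) \<le> norm X * norm Y * K"
    using bounded_bilinear.pos_bounded[OF bounded_bilinear_matrix_mult] by blast
  obtain T where T: "T > 0" "\<And>(X :: real^'n^'n). norm (transpose X) \<le> norm X * T"
    using bounded_linear.pos_bounded[OF bounded_linear_transpose] by blast
  obtain b where b: "\<And>r. norm (B r) \<le> b" using B(2) by (auto simp: bounded_iff)
  then have "b \<ge> 0" using norm_ge_zero order_trans by blast
  have "norm (U t r ** B r ** transpose (B r) ** transpose (U t r))
      \<le> ((C * b * K) * (C * b * K) * T * K) * exp (- \<omega> * (t - r))" if "r \<le> t" for r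
  proof -
    define e where "e = exp (- \<omega> * (t - r))"
    have e: "0 \<le> e" "e \<le> 1" using that \<open>\<omega> > 0\<close> by (auto simp: e_def)
    have "C * e \<ge> 0" using order_trans[OF norm_ge_zero U[OF that]] by (simp add: e_def)
    have "norm (U t r ** B r) \<le> norm (U t r) * norm (B r) * K" by (rule K)
    also have "\<dots> \<le> (C * e) * b * K"
      using K(1) \<open>b \<ge> 0\<close> \<open>C * e \<ge> 0\<close> U[OF that]
      by (intro mult_right_mono mult_mono b) (auto simp: e_def)
    finally have UB: "norm (U t r ** B r) \<le> (C * b * K) * e" by (simp add: mult_ac)
    have "norm (U t r ** B r ** transpose (B r) ** transpose (U t r))
        \<le> norm (U t r ** B r) * norm (transpose (U t r ** B r)) * K"
      unfolding covariance_integrand_eq by (rule K)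
    also have "\<dots> \<le> norm (U t r ** B r) * (norm (U t r ** B r) * T) * K"
      using K(1) by (intro mult_right_mono mult_left_mono T) auto
    also have "\<dots> \<le> ((C * b * K) * e) * (((C * b * K) * e) * T) * K"
      using K(1) T(1) order_trans[OF norm_ge_zero UB] by (intro mult_right_mono mult_mono UB) auto
    also have "\<dots> = ((C * b * K) * (C * b * K) * T * K) * (e * e)" by (simp add: mult_ac)
    \<comment> \<open>The integrand decays at rate 2 \<omega>; weakening this to \<omega> lets the
      same integrability criterion serve drift and covariance.\<close>
    also have "\<dots> \<le> ((C * b * K) * (C * b * K) * T * K) * e"
      using K(1) T(1) e by (intro mult_left_mono) (auto simp: mult_left_le)
    finally show ?thesis by (simp add: e_def)
  qed
  moreover have "continuous_on {..t} (\<lambda>r. U t r ** B r ** transpose (B r) ** transpose (U t r))"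
    by (intro bounded_bilinear.continuous_on[OF bounded_bilinear_matrix_mult]
        bounded_linear.continuous_on[OF bounded_linear_transpose] cont
        continuous_on_subset[OF B(1)]) auto
  ultimately show ?thesis using \<open>\<omega> > 0\<close> by (intro set_integrable_if_exp_decay)
qed

section \<open>The evolution identity\<close>

text \<open>\<open>OU_operator\<close> acts on real functions, so the exponential is treated through
  its real and imaginary parts. The mean U(t,s) x contributes the phase (U(t,s) x) \<bullet> h = x
  \<bullet> k, which is where the transposed argument k originates.\<close>

lemma OU_operator_trig:
  fixes U :: "real \<Rightarrow> real \<Rightarrow> real^'n^'n" and f :: "real \<Rightarrow> real^'n" and h :: "real^'n"
  assumes "psd_matrix (covar U B t (ereal s))"
  defines "c \<equiv> gaussian_char (drift U f t (ereal s)) (covar U B t (ereal s)) h"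
    and "k \<equiv> transpose (U t s) *v h"
  shows "OU_operator U B f s t (\<lambda>x. cos (x \<bullet> h)) x = Re (c * iexp (x \<bullet> k))"
    and "OU_operator U B f s t (\<lambda>x. sin (x \<bullet> h)) x = Im (c * iexp (x \<bullet> k))"
proof -
  define G where "G = gaussian (U t s *v x) (covar U B t (ereal s))"
  define g where "g = drift U f t (ereal s)"
  note G = gaussian_properties[OF assms(1), of "U t s *v x", folded G_def]
  have "(CLINT y|G. iexp ((y + g) \<bullet> h)) = (CLINT y|G. iexp (g \<bullet> h) * iexp (y \<bullet> h))"
    by (intro Bochner_Integration.integral_cong) (auto simp: inner_add_left mult_exp_exp algebra_simps)
  also have "\<dots> = iexp (g \<bullet> h) * mchar G h" by (simp add: mchar_def)
  also have "\<dots> = c * iexp (x \<bullet> k)"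
    by (simp only: G(3) gaussian_char_def c_def k_def g_def inner_transpose_mult mult_ac)
  finally have eq: "(CLINT y|G. iexp ((y + g) \<bullet> h)) = c * iexp (x \<bullet> k)" .
  interpret prob_space G by (rule G)
  have [measurable_cong]: "sets G = sets borel" by (rule G)
  have int: "integrable G (\<lambda>y. iexp ((y + g) \<bullet> h))" by (rule integrable_iexp) auto
  show "OU_operator U B f s t (\<lambda>x. cos (x \<bullet> h)) x = Re (c * iexp (x \<bullet> k))"
    unfolding OU_operator_def G_def[symmetric] g_def[symmetric] eq[symmetric] integral_Re[OF int, symmetric]
    by (simp add: Re_exp)
  show "OU_operator U B f s t (\<lambda>x. sin (x \<bullet> h)) x = Im (c * iexp (x \<bullet> k))"
    unfolding OU_operator_def G_def[symmetric] g_def[symmetric] eq[symmetric] integral_Im[OF int, symmetric]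
    by (simp add: Im_exp)
qed

lemma mchar_evolution:
  fixes U :: "real \<Rightarrow> real \<Rightarrow> real^'n^'n"
  assumes \<nu>: "evolution_system_of_measures (OU_operator U B f) \<nu>" and "s \<le> t"
    and psd: "psd_matrix (covar U B t (ereal s))"
  shows "mchar (\<nu> t) h = gaussian_char (drift U f t (ereal s)) (covar U B t (ereal s)) h *
    mchar (\<nu> s) (transpose (U t s) *v h)"
proof -
  define c where "c = gaussian_char (drift U f t (ereal s)) (covar U B t (ereal s)) h"
  define k where "k = transpose (U t s) *v h"
  have \<nu>t: "prob_space (\<nu> t)" "sets (\<nu> t) = sets borel" for t
    using \<nu> by (auto simp: evolution_system_of_measures_def)
  have ev: "(\<integral>x. OU_operator U B f s t \<phi> x \<partial>\<nu> s) = (\<integral>x. \<phi> x \<partial>\<nu> t)" if "\<phi> \<in> bcontfun" for \<phi>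
    using \<nu> that \<open>s \<le> t\<close> by (auto simp: evolution_system_of_measures_def)
  have bc: "(\<lambda>x. cos (x \<bullet> h)) \<in> bcontfun" "(\<lambda>x. sin (x \<bullet> h)) \<in> bcontfun"
    by (auto simp: bcontfun_def bounded_iff intro!: continuous_intros exI[of _ 1])
  note int = integrable_iexp_inner[OF \<nu>t]
  have intc: "integrable (\<nu> s) (\<lambda>x. c * iexp (x \<bullet> k))" by (intro integrable_mult_right int)
  have "Re (mchar (\<nu> t) h) = (\<integral>x. cos (x \<bullet> h) \<partial>\<nu> t)"
    unfolding mchar_def integral_Re[OF int, symmetric] by (simp add: Re_exp)
  also have "\<dots> = Re (c * mchar (\<nu> s) k)"
    unfolding ev[OF bc(1), symmetric] OU_operator_trig(1)[OF psd] c_def[symmetric] k_def[symmetric]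
      integral_Re[OF intc] by (simp add: mchar_def)
  finally have Re: "Re (mchar (\<nu> t) h) = Re (c * mchar (\<nu> s) k)" .
  have "Im (mchar (\<nu> t) h) = (\<integral>x. sin (x \<bullet> h) \<partial>\<nu> t)"
    unfolding mchar_def integral_Im[OF int, symmetric] by (simp add: Im_exp)
  also have "\<dots> = Im (c * mchar (\<nu> s) k)"
    unfolding ev[OF bc(2), symmetric] OU_operator_trig(2)[OF psd] c_def[symmetric] k_def[symmetric]
      integral_Im[OF intc] by (simp add: mchar_def)
  finally show ?thesis using Re by (simp add: complex_eq_iff c_def k_def)
qed

section \<open>Equicontinuity at 0 from a fractional moment\<close>

text \<open>Interpolates between the Lipschitz bound for small u and the trivial bound 2; for small
  u, \<beta> \<le> 1 gives \<open>\<bar>u\<bar> \<le> \<bar>u\<bar> powr \<beta>\<close>.\<close>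

lemma norm_iexp_minus_1_le_powr:
  assumes "0 < \<beta>" "\<beta> \<le> 1"
  shows "norm (iexp u - 1) \<le> 2 * \<bar>u\<bar> powr \<beta>"
proof (cases "\<bar>u\<bar> \<le> 1")
  case True
  have "norm (iexp u - 1) \<le> \<bar>u\<bar>" using iexp_approx1[of u 0] by simp
  also have "\<bar>u\<bar> \<le> \<bar>u\<bar> powr \<beta>"
    using True assms powr_mono'[of \<beta> 1 "\<bar>u\<bar>"] by (cases "u = 0") auto
  finally show ?thesis by (smt (verit) powr_ge_zero)
next
  case False
  have "norm (iexp u - 1) \<le> norm (iexp u) + norm (1::complex)" by (rule norm_triangle_ineq4)
  also have "\<dots> \<le> 2" by simp
  also have "1 \<le> \<bar>u\<bar> powr \<beta>" using False assms by (intro ge_one_powr_ge_zero) auto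
  then have "2 \<le> 2 * \<bar>u\<bar> powr \<beta>" by simp
  finally show ?thesis .
qed

text \<open>With \<beta> = min \<alpha> 1, the Hoelder bound needs a moment of order \<beta>, which
  1 plus the moment of order \<alpha> dominates. The estimate depends on M only through c.\<close>

lemma norm_mchar_minus_1_le:
  fixes M :: "'a::euclidean_space measure"
  assumes "prob_space M" "sets M = sets borel" "\<alpha> > 0" "c \<ge> 0"
    and c: "(\<integral>\<^sup>+x. ennreal (norm x powr \<alpha>) \<partial>M) \<le> ennreal c"
  shows "norm (mchar M k - 1) \<le> 2 * norm k powr min \<alpha> 1 * (1 + c)"
proof -
  define \<beta> where "\<beta> = min \<alpha> 1"
  have \<beta>: "0 < \<beta>" "\<beta> \<le> 1" "\<beta> \<le> \<alpha>" using assms(3) by (auto simp: \<beta>_def)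
  interpret prob_space M by fact
  have [measurable_cong]: "sets M = sets borel" by fact
  have int: "integrable M (\<lambda>x. iexp (x \<bullet> k))" by (rule integrable_iexp_inner) fact+
  have pt: "norm (iexp (x \<bullet> k) - 1) \<le> 2 * norm k powr \<beta> * (1 + norm x powr \<alpha>)" for x
  proof -
    have "norm x powr \<beta> \<le> 1 + norm x powr \<alpha>"
    proof (cases "norm x \<le> 1")
      case True
      then have "norm x powr \<beta> \<le> 1" using \<beta> by (intro powr_le1) auto
      then show ?thesis by (smt (verit) powr_ge_zero)
    next
      case False
      then have "norm x powr \<beta> \<le> norm x powr \<alpha>" using \<beta> by (intro powr_mono) auto
      then show ?thesis by simp
    qed
    then have "2 * norm k powr \<beta> * norm x powr \<beta> \<le> 2 * norm k powr \<beta> * (1 + norm x powr \<alpha>)"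
      by (intro mult_left_mono) auto
    moreover have "\<bar>x \<bullet> k\<bar> powr \<beta> \<le> (norm x * norm k) powr \<beta>"
      using \<beta> by (intro powr_mono2 Cauchy_Schwarz_ineq2) auto
    ultimately show ?thesis
      using norm_iexp_minus_1_le_powr[OF \<beta>(1,2), of "x \<bullet> k"] by (simp add: powr_mult mult_ac)
  qed
  have "mchar M k - 1 = (CLINT x|M. iexp (x \<bullet> k) - 1)"
    using int by (simp add: mchar_def prob_space)
  then have "norm (mchar M k - 1) \<le> (\<integral>x. norm (iexp (x \<bullet> k) - 1) \<partial>M)"
    by (simp only: integral_norm_bound)
  then have "ennreal (norm (mchar M k - 1)) \<le> ennreal (\<integral>x. norm (iexp (x \<bullet> k) - 1) \<partial>M)"
    by (rule ennreal_leI)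
  also have "\<dots> = (\<integral>\<^sup>+x. norm (iexp (x \<bullet> k) - 1) \<partial>M)"
    using int by (intro nn_integral_eq_integral[symmetric]) auto
  also have "\<dots> \<le> (\<integral>\<^sup>+x. ennreal (2 * norm k powr \<beta>) * (1 + ennreal (norm x powr \<alpha>)) \<partial>M)"
  proof (rule nn_integral_mono)
    fix x
    show "ennreal (norm (iexp (x \<bullet> k) - 1)) \<le> ennreal (2 * norm k powr \<beta>) * (1 + ennreal (norm x powr \<alpha>))"
      using ennreal_leI[OF pt[of x]] by (simp add: ennreal_mult' ennreal_plus)
  qed
  also have "\<dots> = ennreal (2 * norm k powr \<beta>) * (1 + (\<integral>\<^sup>+x. ennreal (norm x powr \<alpha>) \<partial>M))"
    by (simp add: nn_integral_cmult nn_integral_add emeasure_space_1)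
  also have "\<dots> \<le> ennreal (2 * norm k powr \<beta>) * (1 + ennreal c)"
    by (intro mult_left_mono add_left_mono c) auto
  also have "\<dots> = ennreal (2 * norm k powr \<beta> * (1 + c))"
    using \<open>c \<ge> 0\<close> by (simp add: ennreal_mult' ennreal_plus)
  finally show ?thesis
    using \<open>c \<ge> 0\<close> by (subst (asm) ennreal_le_iff) (auto simp: \<beta>_def)
qed

theorem lemma2p3:
  fixes A B :: "real \<Rightarrow> real^'n^'n" and f :: "real \<Rightarrow> real^'n"
    and U :: "real \<Rightarrow> real \<Rightarrow> real^'n^'n" and \<mu>\<^sub>0 :: real
    and \<nu> :: "real \<Rightarrow> (real^'n) measure"
  assumes "continuous_on UNIV A" and "bounded (range A)"
    and "continuous_on UNIV B" and "bounded (range B)"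
    and "continuous_on UNIV f" and "bounded (range f)"
    and "\<mu>\<^sub>0 > 0" and "\<And>t x. norm (B t *v x) \<ge> \<mu>\<^sub>0 * norm x"
    and "evolution_family A U" and "growth_bound U < 0"
    and "evolution_system_of_measures (OU_operator U B f) \<nu>"
    and "\<exists>\<alpha>>0. (SUP t. \<integral>\<^sup>+x. ennreal (norm x powr \<alpha>) \<partial>\<nu> t) < \<infinity>"
  shows "\<forall>t. \<nu> t = gaussian (drift U f t (-\<infinity>)) (covar U B t (-\<infinity>))"
proof
  fix t
  obtain \<omega> C where \<omega>: "\<omega> > 0" "C \<ge> 0" "\<And>s t. s \<le> t \<Longrightarrow> norm (U t s) \<le> C * exp (- \<omega> * (t - s))"
    by (rule growth_bound_negativeE[OF assms(10)]) (rule that)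
  have cont: "continuous_on {..t} (U t)"
    by (rule continuous_on_evolution_family_left[OF assms(9,2) \<omega>])
  have intg: "set_integrable lborel {..t} (\<lambda>r. U t r *v f r)"
    using cont \<omega>(1) \<omega>(3) assms(5,6) by (rule set_integrable_drift)
  have intQ: "set_integrable lborel {..t} (\<lambda>r. U t r ** B r ** transpose (B r) ** transpose (U t r))"
    using cont \<omega>(1) \<omega>(3) assms(3,4) by (rule set_integrable_covar)
  \<comment> \<open>The extended lower limit includes \<open>-\<infinity>\<close>, where the claim
    is needed to identify the target Gaussian.\<close>
  have psd: "psd_matrix (covar U B t s)" if "s \<le> ereal t" for s
    unfolding covar_def
    by (rule psd_matrix_interval_integral[OF intQ _ that])
      (simp only: covariance_integrand_eq psd_matrix_mult_transpose)
  have limg: "((\<lambda>s. drift U f t (ereal s)) \<longlongrightarrow> drift U f t (-\<infinity>)) at_bot"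
    unfolding drift_def by (rule tendsto_interval_integral_at_bot[OF intg])
  have limQ: "((\<lambda>s. covar U B t (ereal s)) \<longlongrightarrow> covar U B t (-\<infinity>)) at_bot"
    unfolding covar_def by (rule tendsto_interval_integral_at_bot[OF intQ])
  have \<nu>: "prob_space (\<nu> t)" "sets (\<nu> t) = sets borel" for t
    using assms(11) by (auto simp: evolution_system_of_measures_def)
  obtain \<alpha> where \<alpha>: "\<alpha> > 0" "(SUP t. \<integral>\<^sup>+x. ennreal (norm x powr \<alpha>) \<partial>\<nu> t) < \<infinity>"
    using assms(12) by blast
  define c where "c = enn2real (SUP t. \<integral>\<^sup>+x. ennreal (norm x powr \<alpha>) \<partial>\<nu> t)"
  have c: "(\<integral>\<^sup>+x. ennreal (norm x powr \<alpha>) \<partial>\<nu> t) \<le> ennreal c" for t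
  proof -
    have "ennreal c = (SUP t. \<integral>\<^sup>+x. ennreal (norm x powr \<alpha>) \<partial>\<nu> t)"
      using \<alpha>(2) by (simp add: c_def)
    then show ?thesis by (simp only:) (intro SUP_upper UNIV_I)
  qed
  have "mchar (\<nu> t) h = gaussian_char (drift U f t (-\<infinity>)) (covar U B t (-\<infinity>)) h" for h
  proof -
    define k where "k s = transpose (U t s) *v h" for s
    have "((\<lambda>s. C * exp (- \<omega> * (t - s))) \<longlongrightarrow> 0) at_bot"
    proof -
      have "LIM s at_bot. - \<omega> * t + \<omega> * s :> at_bot"
        unfolding filterlim_at_bot
      proof
        fix Z
        show "eventually (\<lambda>s. - \<omega> * t + \<omega> * s \<le> Z) at_bot"
          using eventually_le_at_bot[of "Z / \<omega> + t"]
          by eventually_elim (use \<omega>(1) in \<open>simp add: field_simps\<close>)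
      qed
      then have "((\<lambda>s. exp (- \<omega> * t + \<omega> * s)) \<longlongrightarrow> 0) at_bot"
        by (rule filterlim_compose[OF exp_at_bot])
      from tendsto_mult_right_zero[OF this, of C] show ?thesis by (simp add: algebra_simps)
    qed
    then have "((\<lambda>s. U t s) \<longlongrightarrow> 0) at_bot"
      by (rule Lim_null_comparison[rotated]) (rule eventually_mono[OF eventually_le_at_bot[of t] \<omega>(3)])
    then have "(k \<longlongrightarrow> transpose 0 *v h) at_bot"
      unfolding k_def[abs_def]
      by (intro bounded_bilinear.tendsto[OF bounded_bilinear_matrix_vector_mult]
          bounded_linear.tendsto[OF bounded_linear_transpose] tendsto_const)
    then have k0: "(k \<longlongrightarrow> 0) at_bot"
      by (simp add: linear_0[OF bounded_linear.linear[OF bounded_linear_transpose]])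
    have "((\<lambda>s. 2 * norm (k s) powr min \<alpha> 1 * (1 + c)) \<longlongrightarrow> 2 * 0 * (1 + c)) at_bot"
      using \<alpha>(1) by (intro tendsto_mult tendsto_const tendsto_zero_powrI[OF tendsto_norm_zero[OF k0] tendsto_const]) auto
    then have null: "((\<lambda>s. 2 * norm (k s) powr min \<alpha> 1 * (1 + c)) \<longlongrightarrow> 0) at_bot" by simp
    \<comment> \<open>The constant c is the same for all s, so the bound tends to 0 although the
      measure varies with s.\<close>
    have "norm (mchar (\<nu> s) (k s) - 1) \<le> 2 * norm (k s) powr min \<alpha> 1 * (1 + c)" for s
      by (rule norm_mchar_minus_1_le[OF \<nu> \<alpha>(1) _ c]) (simp add: c_def)
    then have "((\<lambda>s. mchar (\<nu> s) (k s) - 1) \<longlongrightarrow> 0) at_bot"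
      by (rule Lim_null_comparison[OF always_eventually null, OF allI])
    then have lim1: "((\<lambda>s. mchar (\<nu> s) (k s)) \<longlongrightarrow> 1) at_bot" by (rule LIM_zero_cancel)
    have lim2: "((\<lambda>s. gaussian_char (drift U f t (ereal s)) (covar U B t (ereal s)) h) \<longlongrightarrow>
        gaussian_char (drift U f t (-\<infinity>)) (covar U B t (-\<infinity>)) h) at_bot"
      unfolding gaussian_char_def
      by (intro tendsto_intros limg
          bounded_bilinear.tendsto[OF bounded_bilinear_matrix_vector_mult limQ tendsto_const]) auto
    \<comment> \<open>For s \<le> t the product does not depend on s, so its limit is its constant
      value.\<close>
    have "eventually (\<lambda>s. gaussian_char (drift U f t (ereal s)) (covar U B t (ereal s)) h *
        mchar (\<nu> s) (k s) = mchar (\<nu> t) h) at_bot"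
      using eventually_le_at_bot[of t]
      by eventually_elim (simp only: k_def mchar_evolution[OF assms(11) _ psd] ereal_less_eq(3))
    with tendsto_mult[OF lim2 lim1]
    have "((\<lambda>s::real. mchar (\<nu> t) h) \<longlongrightarrow> gaussian_char (drift U f t (-\<infinity>)) (covar U B t (-\<infinity>)) h * 1) at_bot"
      by (rule Lim_transform_eventually)
    then show ?thesis by (simp only: tendsto_const_iff trivial_limit_at_bot_linorder mult_1_right not_False_eq_True)
  qed
  then show "\<nu> t = gaussian (drift U f t (-\<infinity>)) (covar U B t (-\<infinity>))"
    by (intro gaussian_eqI \<nu> psd) auto
qed

end
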